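(* Let $\Delta=(m_U-m_L)/m_U$. Suppose that $g$, $h$ and $m_U$ are bounded, that all variance components are bounded, and that $0\le\Delta<1/2$. Then for every $r=0,1,2,\dots$ $$\mathbf V^{-1}=\Bigl(\sum_{l=0}^{r}(-\sigma_e^2)^l\bigl(\check{\mathbf V}^{-1}\mathbf I_{\mathbf m}^{\Delta}\bigr)^l\Bigr)\check{\mathbf V}^{-1}+\mathbf O_{[n:n]}\!\left(\frac{\Delta^{r+1}}{(1-\Delta)^{r+1}}\right),$$ where $\mathbf I_{\mathbf m}^{\Delta}=\operatorname{diag}[(1-m_{ij}/m_U)\mathbf I_{m_{ij}}]$.
   Context: Setting. $g,h\ge 1$ are integers, $m_{ij}\ge 1$ ($1\le i\le g$, $1\le j\le h$) are integers (cell sizes), $n=\sum_{i,j}m_{ij}$, $m_L=\min_{i,j}m_{ij}$, $m_U=\max_{i,j}m_{ij}$. The $n$ observations are indexed by triples $(i,j,k)$, $1\le k\le m_{ij}$, in lexicographic order. The variance components $\sigma_\alpha^2,\sigma_\beta^2,\sigma_\gamma^2\ge0$, $\sigma_e^2>0$ are (fixed) parameters of the two-way crossed random effects model with interaction $y_{ijk}=\mu(\mathbf x_{ijk})+\alpha_i+\beta_j+\gamma_{ij}+e_{ijk}$. Matrices. $\mathbf D$ is the $n\times n$ matrix with entries $\mathbf D_{(i,j,k),(i',j',k')}=\sigma_\alpha^2\mathbb 1[i=i']+\sigma_\beta^2\mathbb 1[j=j']+\sigma_\gamma^2\mathbb 1[(i,j)=(i',j')]$. The covariance matrix is $\mathbf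 V=\sigma_e^2\mathbf I_n+\mathbf D$, and the modified covariance matrix is $\check{\mathbf V}=\frac{\sigma_e^2}{m_U}\mathbf I_{\mathbf m}^M+\mathbf D$ with $\mathbf I_{\mathbf m}^M=\operatorname{diag}(m_{11}\mathbf I_{m_{11}},\dots,m_{gh}\mathbf I_{m_{gh}})$. Both are positive definite. $\operatorname{diag}[\mathbf A_{ij}]$ is the block-diagonal matrix with $m_{ij}\times m_{ij}$ blocks $\mathbf A_{ij}$, cells in lexicographic order. $\mathbf O_{[n:n]}(a)$ denotes an $n\times n$ matrix all of whose entries are of order $O(a)$, i.e. bounded in absolute value by a constant times $a$, the constant being uniform over all designs satisfying the stated bounds (it may depend on those bounds, on the variance components and on $r$). *)

theory Defs
  imports Complex_Main "Jordan_Normal_Form.Gauss_Jordan_Elimination"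
begin

text \<open>
  A design is given by \<open>g\<close>, \<open>h\<close> and the cell sizes \<open>m i j\<close>. Levels and observations are numbered
  from \<open>0\<close>, so the cells are the pairs with \<open>i < g\<close> and \<open>j < h\<close>; values of \<open>m\<close> outside this range
  are irrelevant. Variance components are passed as the variances themselves
  (\<open>va\<close>, \<open>vb\<close>, \<open>vc\<close>, \<open>ve\<close> for the two main effects, the interaction and the error).
\<close>

definition crossed_design :: "nat \<Rightarrow> nat \<Rightarrow> (nat \<Rightarrow> nat \<Rightarrow> nat) \<Rightarrow> bool" where
  "crossed_design g h m \<longleftrightarrow> g \<ge> 1 \<and> h \<ge> 1 \<and> (\<forall>i<g. \<forall>j<h. m i j \<ge> 1)"

definition n_obs :: "nat \<Rightarrow> nat \<Rightarrow> (nat \<Rightarrow> nat \<Rightarrow> nat) \<Rightarrow> nat" where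
  "n_obs g h m = (\<Sum>i<g. \<Sum>j<h. m i j)"

definition m_L :: "nat \<Rightarrow> nat \<Rightarrow> (nat \<Rightarrow> nat \<Rightarrow> nat) \<Rightarrow> nat" where
  "m_L g h m = Min ((\<lambda>(i, j). m i j) ` ({..<g} \<times> {..<h}))"

definition m_U :: "nat \<Rightarrow> nat \<Rightarrow> (nat \<Rightarrow> nat \<Rightarrow> nat) \<Rightarrow> nat" where
  "m_U g h m = Max ((\<lambda>(i, j). m i j) ` ({..<g} \<times> {..<h}))"

definition imbalance :: "nat \<Rightarrow> nat \<Rightarrow> (nat \<Rightarrow> nat \<Rightarrow> nat) \<Rightarrow> real" where
  "imbalance g h m = (real (m_U g h m) - real (m_L g h m)) / real (m_U g h m)"

text \<open>Cells and observations in lexicographic order; row and column \<open>a\<close> of a matrix belong to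
  the observation \<open>obs g h m ! a\<close>.\<close>

definition cells :: "nat \<Rightarrow> nat \<Rightarrow> (nat \<times> nat) list" where
  "cells g h = [(i, j). i \<leftarrow> [0..<g], j \<leftarrow> [0..<h]]"

definition obs :: "nat \<Rightarrow> nat \<Rightarrow> (nat \<Rightarrow> nat \<Rightarrow> nat) \<Rightarrow> (nat \<times> nat \<times> nat) list" where
  "obs g h m = [(i, j, k). i \<leftarrow> [0..<g], j \<leftarrow> [0..<h], k \<leftarrow> [0..<m i j]]"

lemma length_obs: "length (obs g h m) = n_obs g h m"
  by (simp add: obs_def n_obs_def length_concat comp_def atLeast0LessThan
      interv_sum_list_conv_sum_set_nat)

definition diag_cells ::
  "nat \<Rightarrow> nat \<Rightarrow> (nat \<Rightarrow> nat \<Rightarrow> real mat) \<Rightarrow> real mat" where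
  "diag_cells g h A = diag_block_mat (map (\<lambda>(i, j). A i j) (cells g h))"

lemma diag_cells_carrier:
  assumes "\<And>i j. A i j \<in> carrier_mat (m i j) (m i j)"
  shows "diag_cells g h A \<in> carrier_mat (n_obs g h m) (n_obs g h m)"
proof -
  have "dim_row (A i j) = m i j" "dim_col (A i j) = m i j" for i j
    using assms[of i j] by auto
  moreover have "sum_list (concat xss) = sum_list (map sum_list xss)" for xss :: "nat list list"
    by (induction xss) simp_all
  ultimately show ?thesis
    by (intro carrier_matI)
       (simp_all add: diag_cells_def dim_diag_block_mat cells_def n_obs_def map_concat comp_def
         atLeast0LessThan interv_sum_list_conv_sum_set_nat)
qed

definition D_mat ::
  "real \<Rightarrow> real \<Rightarrow> real \<Rightarrow> nat \<Rightarrow> nat \<Rightarrow> (nat \<Rightarrow> nat \<Rightarrow> nat) \<Rightarrow> real mat" where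
  "D_mat va vb vc g h m = mat (n_obs g h m) (n_obs g h m) (\<lambda>(a, b).
     case (obs g h m ! a, obs g h m ! b) of ((i, j, k), (i', j', k')) \<Rightarrow>
       va * of_bool (i = i') + vb * of_bool (j = j') + vc * of_bool ((i, j) = (i', j')))"

definition I_m_M :: "nat \<Rightarrow> nat \<Rightarrow> (nat \<Rightarrow> nat \<Rightarrow> nat) \<Rightarrow> real mat" where
  "I_m_M g h m = diag_cells g h (\<lambda>i j. real (m i j) \<cdot>\<^sub>m 1\<^sub>m (m i j))"

definition I_m_Delta :: "nat \<Rightarrow> nat \<Rightarrow> (nat \<Rightarrow> nat \<Rightarrow> nat) \<Rightarrow> real mat" where
  "I_m_Delta g h m =
     diag_cells g h (\<lambda>i j. (1 - real (m i j) / real (m_U g h m)) \<cdot>\<^sub>m 1\<^sub>m (m i j))"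

definition V_mat ::
  "real \<Rightarrow> real \<Rightarrow> real \<Rightarrow> real \<Rightarrow> nat \<Rightarrow> nat \<Rightarrow> (nat \<Rightarrow> nat \<Rightarrow> nat) \<Rightarrow> real mat" where
  "V_mat va vb vc ve g h m = ve \<cdot>\<^sub>m 1\<^sub>m (n_obs g h m) + D_mat va vb vc g h m"

definition V_check ::
  "real \<Rightarrow> real \<Rightarrow> real \<Rightarrow> real \<Rightarrow> nat \<Rightarrow> nat \<Rightarrow> (nat \<Rightarrow> nat \<Rightarrow> nat) \<Rightarrow> real mat" where
  "V_check va vb vc ve g h m =
     (ve / real (m_U g h m)) \<cdot>\<^sub>m I_m_M g h m + D_mat va vb vc g h m"

text \<open>\<open>mat_inverse\<close> returns \<open>None\<close> exactly for non-invertible square matrices; \<open>minv\<close> is only meant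
  for invertible arguments.\<close>

abbreviation minv :: "real mat \<Rightarrow> real mat" where
  "minv A \<equiv> the (mat_inverse A)"

abbreviation msum :: "nat \<Rightarrow> (nat \<Rightarrow> real mat) \<Rightarrow> nat set \<Rightarrow> real mat" where
  "msum n F S \<equiv> finsum (ring_mat TYPE(real) n ()) F S"

definition entries_bounded_by :: "real mat \<Rightarrow> real \<Rightarrow> bool" where
  "entries_bounded_by A c \<longleftrightarrow> (\<forall>a<dim_row A. \<forall>b<dim_col A. \<bar>A $$ (a, b)\<bar> \<le> c)"

end

theory Submission
  imports Defs "Jordan_Normal_Form.Determinant"
begin

text \<open>
  Since \<open>V = V_check + ve I_m_Delta\<close>, the two inverses satisfy the resolvent identity
  \<open>V\<inverse> = V_check\<inverse> - ve V_check\<inverse> I_m_Delta V\<inverse>\<close>. Iterating it \<open>r + 1\<close> times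
  gives the sum with remainder \<open>(-ve)^(r+1) (V_check\<inverse> I_m_Delta)^(r+1) V\<inverse>\<close>. With \<open>\<Delta>\<close> the
  imbalance, \<open>D\<close> positive semidefinite makes the quadratic forms of \<open>V\<close> and \<open>V_check\<close> at least
  \<open>ve\<close> and \<open>ve (1 - \<Delta>)\<close>, so the spectral norm of the remainder is at most
  \<open>(\<Delta> / (1 - \<Delta>))^(r+1) / ve\<close>.
\<close>

section \<open>Quadratic form bounds from below and operator norm bounds from above\<close>

text \<open>For symmetric \<open>A\<close> this bounds all eigenvalues below by \<open>c\<close>;
  the case \<open>c = 0\<close> is positive semidefiniteness. Symmetry is not part of the
  notion.\<close>

definition coercive :: "real \<Rightarrow> real mat \<Rightarrow> bool" where
  "coercive c A \<longleftrightarrow> (\<forall>x \<in> carrier_vec (dim_col A). c * (x \<bullet> x) \<le> x \<bullet> (A *\<^sub>v x))"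

text \<open>This is the spectral norm bound, squared to avoid square roots. The conjunct
  \<open>0 \<le> c\<close> restores the sign lost by squaring, so that absolute values can be
  compared with \<open>c\<close> later.\<close>

definition op_bounded :: "real \<Rightarrow> real mat \<Rightarrow> bool" where
  "op_bounded c A \<longleftrightarrow>
     0 \<le> c \<and> (\<forall>x \<in> carrier_vec (dim_col A). (A *\<^sub>v x) \<bullet> (A *\<^sub>v x) \<le> c\<^sup>2 * (x \<bullet> x))"

lemma scalar_prod_self_nonneg: "0 \<le> x \<bullet> (x :: real vec)"
  by (auto simp: scalar_prod_def intro: sum_nonneg)

lemma coercive_add:
  assumes "A \<in> carrier_mat n n" "B \<in> carrier_mat n n" "coercive a A" "coercive b B"
  shows "coercive (a + b) (A + B)"
  unfolding coercive_def
proof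
  fix x :: "real vec" assume "x \<in> carrier_vec (dim_col (A + B))"
  with assms have x: "x \<in> carrier_vec n" by auto
  have "x \<bullet> ((A + B) *\<^sub>v x) = x \<bullet> (A *\<^sub>v x) + x \<bullet> (B *\<^sub>v x)"
    using x assms(1,2)
    by (simp add: add_mult_distrib_mat_vec[of _ n n] scalar_prod_add_distrib[of _ n])
  moreover have "a * (x \<bullet> x) \<le> x \<bullet> (A *\<^sub>v x)" "b * (x \<bullet> x) \<le> x \<bullet> (B *\<^sub>v x)"
    using x assms by (auto simp: coercive_def)
  ultimately show "(a + b) * (x \<bullet> x) \<le> x \<bullet> ((A + B) *\<^sub>v x)"
    by (simp add: distrib_right)
qed

lemma coercive_smult:
  assumes "A \<in> carrier_mat n n" "coercive a A" "0 \<le> k"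
  shows "coercive (k * a) (k \<cdot>\<^sub>m A)"
  unfolding coercive_def
proof
  fix x :: "real vec" assume "x \<in> carrier_vec (dim_col (k \<cdot>\<^sub>m A))"
  with assms have x: "x \<in> carrier_vec n" by auto
  have "(k \<cdot>\<^sub>m A) *\<^sub>v x = k \<cdot>\<^sub>v (A *\<^sub>v x)"
    using x assms(1) by (intro eq_vecI) auto
  then have "x \<bullet> ((k \<cdot>\<^sub>m A) *\<^sub>v x) = k * (x \<bullet> (A *\<^sub>v x))"
    using x assms(1) by (simp add: scalar_prod_smult_right)
  moreover have "a * (x \<bullet> x) \<le> x \<bullet> (A *\<^sub>v x)"
    using x assms by (auto simp: coercive_def)
  ultimately show "k * a * (x \<bullet> x) \<le> x \<bullet> ((k \<cdot>\<^sub>m A) *\<^sub>v x)"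
    using \<open>0 \<le> k\<close> by (simp add: mult.assoc mult_left_mono)
qed

section \<open>Indicator matrices of factor levels\<close>

text \<open>This is Z Z^T for the incidence matrix Z of a factor that puts observation
  \<open>a\<close> at level \<open>f a\<close>.\<close>

definition level_mat :: "nat \<Rightarrow> (nat \<Rightarrow> 'b) \<Rightarrow> real mat" where
  "level_mat n f = mat n n (\<lambda>(a, b). of_bool (f a = f b))"

lemma level_mat_carrier [simp]: "level_mat n f \<in> carrier_mat n n"
  by (simp add: level_mat_def)

text \<open>The quadratic form is the sum of the squared level totals.\<close>

lemma coercive_level_mat: "coercive 0 (level_mat n f)"
  unfolding coercive_def
proof
  fix x :: "real vec" assume "x \<in> carrier_vec (dim_col (level_mat n f))"
  then have x: "dim_vec x = n" by (auto simp: level_mat_def)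
  have "x \<bullet> (level_mat n f *\<^sub>v x)
      = (\<Sum>a = 0..<n. \<Sum>b = 0..<n. x $ a * (of_bool (f a = f b) * x $ b))"
    using x by (simp add: scalar_prod_def level_mat_def sum_distrib_left
        del: sum_of_bool_mult_eq sum_mult_of_bool_eq)
  \<comment> \<open>The indicator of \<open>f a = f b\<close> is split over the possible common
    level \<open>y\<close>, which separates the dependence on \<open>a\<close> from that on
    \<open>b\<close>.\<close>
  also have "\<dots> = (\<Sum>a = 0..<n. \<Sum>b = 0..<n. \<Sum>y\<in>f ` {0..<n}.
      (of_bool (f a = y) * x $ a) * (of_bool (f b = y) * x $ b))"
  proof (intro sum.cong refl)
    fix a b assume a: "a \<in> {0..<n}"
    have "(\<Sum>y\<in>f ` {0..<n}. (of_bool (f a = y) * x $ a) * (of_bool (f b = y) * x $ b))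
        = (\<Sum>y\<in>f ` {0..<n}. if f a = y then x $ a * (of_bool (f b = y) * x $ b) else 0)"
      by (intro sum.cong) auto
    also have "\<dots> = x $ a * (of_bool (f a = f b) * x $ b)"
      using a by (subst sum.delta') auto
    finally show "x $ a * (of_bool (f a = f b) * x $ b)
      = (\<Sum>y\<in>f ` {0..<n}. (of_bool (f a = y) * x $ a) * (of_bool (f b = y) * x $ b))" ..
  qed
  also have "\<dots> = (\<Sum>a = 0..<n. \<Sum>y\<in>f ` {0..<n}. \<Sum>b = 0..<n.
      (of_bool (f a = y) * x $ a) * (of_bool (f b = y) * x $ b))"
    by (intro sum.cong refl sum.swap)
  also have "\<dots> = (\<Sum>y\<in>f ` {0..<n}. \<Sum>a = 0..<n. \<Sum>b = 0..<n.
      (of_bool (f a = y) * x $ a) * (of_bool (f b = y) * x $ b))"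
    by (rule sum.swap)
  also have "\<dots> = (\<Sum>y\<in>f ` {0..<n}. (\<Sum>a = 0..<n. of_bool (f a = y) * x $ a)\<^sup>2)"
    by (simp only: power2_eq_square sum_product)
  finally show "0 * (x \<bullet> x) \<le> x \<bullet> (level_mat n f *\<^sub>v x)"
    by (simp add: sum_nonneg)
qed

section \<open>Diagonal matrices\<close>

definition diag_of_list :: "real list \<Rightarrow> real mat" where
  "diag_of_list d = mat (length d) (length d) (\<lambda>(a, b). if a = b then d ! a else 0)"

lemma diag_of_list_carrier [simp]: "diag_of_list d \<in> carrier_mat (length d) (length d)"
  by (simp add: diag_of_list_def)

lemma diag_of_list_mult_vec:
  assumes "x \<in> carrier_vec (length d)"
  shows "diag_of_list d *\<^sub>v x = vec (length d) (\<lambda>a. d ! a * x $ a)"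
proof (rule eq_vecI)
  fix a assume "a < dim_vec (vec (length d) (\<lambda>a. d ! a * x $ a))"
  then have a: "a < length d" by simp
  then have "(diag_of_list d *\<^sub>v x) $ a
      = (\<Sum>b = 0..<length d. if a = b then d ! a * x $ b else 0)"
    using assms a
    by (simp add: diag_of_list_def scalar_prod_def if_distrib[of "\<lambda>t. t * _"] cong: if_cong)
  with a show "(diag_of_list d *\<^sub>v x) $ a = vec (length d) (\<lambda>a. d ! a * x $ a) $ a"
    by simp
qed (simp add: diag_of_list_def)

lemma coercive_diag_of_list:
  assumes "\<And>t. t \<in> set d \<Longrightarrow> c \<le> t"
  shows "coercive c (diag_of_list d)"
  unfolding coercive_def
proof
  fix x :: "real vec" assume "x \<in> carrier_vec (dim_col (diag_of_list d))"
  then have x: "x \<in> carrier_vec (length d)" by (simp add: diag_of_list_def)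
  have "c * (x $ a * x $ a) \<le> x $ a * (d ! a * x $ a)" if "a < length d" for a
    using mult_right_mono[OF assms[OF nth_mem[OF that]], of "x $ a * x $ a"]
    by (simp add: algebra_simps)
  with x show "c * (x \<bullet> x) \<le> x \<bullet> (diag_of_list d *\<^sub>v x)"
    unfolding diag_of_list_mult_vec[OF x]
    by (auto simp: scalar_prod_def sum_distrib_left intro!: sum_mono)
qed

lemma op_bounded_diag_of_list:
  assumes "\<And>t. t \<in> set d \<Longrightarrow> \<bar>t\<bar> \<le> c" "0 \<le> c"
  shows "op_bounded c (diag_of_list d)"
  unfolding op_bounded_def
proof (intro conjI ballI)
  fix x :: "real vec" assume "x \<in> carrier_vec (dim_col (diag_of_list d))"
  then have x: "x \<in> carrier_vec (length d)" by (simp add: diag_of_list_def)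
  have "d ! a * x $ a * (d ! a * x $ a) \<le> c\<^sup>2 * (x $ a * x $ a)" if "a < length d" for a
  proof -
    have "(d ! a)\<^sup>2 \<le> c\<^sup>2"
      using assms(1)[OF nth_mem[OF that]] assms(2) by (simp add: abs_le_square_iff[symmetric])
    then show ?thesis
      using mult_right_mono[of "(d ! a)\<^sup>2" "c\<^sup>2" "x $ a * x $ a"]
      by (simp add: power2_eq_square algebra_simps)
  qed
  with x show "(diag_of_list d *\<^sub>v x) \<bullet> (diag_of_list d *\<^sub>v x) \<le> c\<^sup>2 * (x \<bullet> x)"
    unfolding diag_of_list_mult_vec[OF x]
    by (auto simp: scalar_prod_def sum_distrib_left intro!: sum_mono)
qed fact

lemma four_block_diag_of_list:
  "four_block_mat (diag_of_list d) (0\<^sub>m (length d) (length e)) (0\<^sub>m (length e) (length d))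
     (diag_of_list e) = diag_of_list (d @ e)"
  by (rule eq_matI) (auto simp: diag_of_list_def nth_append)

text \<open>Scalar blocks flatten to a plain diagonal, whose action on vectors is explicit. The
  induction splits off the first block, and the remaining blocks already form one diagonal.\<close>

lemma diag_block_mat_scalar_blocks:
  "diag_block_mat (map (\<lambda>x. c x \<cdot>\<^sub>m 1\<^sub>m (s x)) xs)
     = diag_of_list (concat (map (\<lambda>x. replicate (s x) (c x)) xs))"
proof (induction xs)
  case Nil
  show ?case by (auto simp: diag_of_list_def)
next
  case (Cons x xs)
  let ?e = "concat (map (\<lambda>x. replicate (s x) (c x)) xs)"
  have "c x \<cdot>\<^sub>m 1\<^sub>m (s x) = diag_of_list (replicate (s x) (c x))"
    by (rule eq_matI) (auto simp: diag_of_list_def)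
  then show ?case
    using Cons four_block_diag_of_list[of "replicate (s x) (c x)" ?e]
    by (simp add: Let_def carrier_matD[OF diag_of_list_carrier])
qed

section \<open>Inverses of coercive matrices\<close>

text \<open>A kernel vector \<open>v\<close> would satisfy
  \<open>c * (v \<bullet> v) \<le> 0\<close> and hence vanish. So the determinant is nonzero,
  \<open>mat_inverse\<close> returns \<open>Some\<close>, and \<open>minv\<close> is a genuine
  two-sided inverse.\<close>

lemma coercive_imp_inverse:
  assumes A: "A \<in> carrier_mat n n" and coe: "coercive c A" and c: "0 < c"
  shows "minv A \<in> carrier_mat n n" "A * minv A = 1\<^sub>m n" "minv A * A = 1\<^sub>m n"
proof -
  have "det A \<noteq> 0"
  proof
    assume "det A = 0"
    then obtain v where v: "v \<in> carrier_vec n" "v \<noteq> 0\<^sub>v n" "A *\<^sub>v v = 0\<^sub>v n"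
      using det_0_iff_vec_prod_zero_field[OF A] by blast
    have "c * (v \<bullet> v) \<le> 0"
      using coe v A by (force simp: coercive_def)
    with c have "v \<bullet> v \<le> 0" by (simp add: mult_le_0_iff)
    with scalar_prod_self_nonneg[of v] have "(\<Sum>i = 0..<n. v $ i * v $ i) = 0"
      using v(1) by (simp add: scalar_prod_def)
    then have "v = 0\<^sub>v n"
      using v(1) by (intro eq_vecI) (auto simp: sum_nonneg_eq_0_iff)
    with v(2) show False by simp
  qed
  then have "A \<in> Units (ring_mat TYPE(real) n ())"
    by (rule det_non_zero_imp_unit[OF A])
  then obtain B where "mat_inverse A = Some B"
    using mat_inverse(1)[OF A, of "()"] by (cases "mat_inverse A") auto
  then show "minv A \<in> carrier_mat n n" "A * minv A = 1\<^sub>m n" "minv A * A = 1\<^sub>m n"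
    using mat_inverse(2)[OF A] by auto
qed

text \<open>For \<open>A x = y\<close>, expand \<open>0 \<le> |y - c x|\<^sup>2\<close> and use \<open>c |x|\<^sup>2 \<le> x \<bullet> y\<close>.\<close>

lemma op_bounded_minv:
  assumes A: "A \<in> carrier_mat n n" and coe: "coercive c A" and c: "0 < c"
  shows "op_bounded (1 / c) (minv A)"
  unfolding op_bounded_def
proof (intro conjI ballI)
  note B = coercive_imp_inverse[OF A coe c]
  fix y :: "real vec" assume "y \<in> carrier_vec (dim_col (minv A))"
  with B(1) have y: "y \<in> carrier_vec n" by auto
  define x where "x = minv A *\<^sub>v y"
  have x: "x \<in> carrier_vec n" using B(1) y by (simp add: x_def)
  have "A *\<^sub>v x = y"
    using assoc_mult_mat_vec[OF A B(1) y] B(2) y by (simp add: x_def)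
  then have le: "c * (x \<bullet> x) \<le> x \<bullet> y"
    using coe x A by (force simp: coercive_def)
  have "0 \<le> (\<Sum>i = 0..<n. (y $ i - c * x $ i)\<^sup>2)"
    by (simp add: sum_nonneg)
  also have "\<dots> = y \<bullet> y - 2 * c * (x \<bullet> y) + c\<^sup>2 * (x \<bullet> x)"
    using x y by (simp add: scalar_prod_def sum_distrib_left sum.distrib[symmetric]
        sum_subtractf[symmetric] power2_eq_square algebra_simps)
  finally have "2 * c * (x \<bullet> y) \<le> y \<bullet> y + c\<^sup>2 * (x \<bullet> x)" by simp
  moreover have "2 * c * (c * (x \<bullet> x)) \<le> 2 * c * (x \<bullet> y)"
    using le c by (intro mult_left_mono) auto
  ultimately have "c\<^sup>2 * (x \<bullet> x) \<le> y \<bullet> y"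
    by (simp add: power2_eq_square)
  with c show "(minv A *\<^sub>v y) \<bullet> (minv A *\<^sub>v y) \<le> (1 / c)\<^sup>2 * (y \<bullet> y)"
    by (simp add: x_def field_simps)
qed (use c in simp)

section \<open>Norms of products and powers, and the passage to entries\<close>

lemma op_bounded_one: "op_bounded 1 (1\<^sub>m n)"
  by (simp add: op_bounded_def)

lemma op_bounded_mult:
  assumes A: "A \<in> carrier_mat n n" and B: "B \<in> carrier_mat n n"
    and "op_bounded a A" "op_bounded b B"
  shows "op_bounded (a * b) (A * B)"
  unfolding op_bounded_def
proof (intro conjI ballI)
  show "0 \<le> a * b" using assms by (simp add: op_bounded_def)
  fix x :: "real vec" assume "x \<in> carrier_vec (dim_col (A * B))"
  with B have x: "x \<in> carrier_vec n" by auto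
  then have Bx: "B *\<^sub>v x \<in> carrier_vec n" using B by simp
  have "(A *\<^sub>v (B *\<^sub>v x)) \<bullet> (A *\<^sub>v (B *\<^sub>v x)) \<le> a\<^sup>2 * ((B *\<^sub>v x) \<bullet> (B *\<^sub>v x))"
    using assms Bx by (auto simp: op_bounded_def)
  also have "\<dots> \<le> a\<^sup>2 * (b\<^sup>2 * (x \<bullet> x))"
    using assms x by (intro mult_left_mono) (auto simp: op_bounded_def)
  finally show "((A * B) *\<^sub>v x) \<bullet> ((A * B) *\<^sub>v x) \<le> (a * b)\<^sup>2 * (x \<bullet> x)"
    using assoc_mult_mat_vec[OF A B x] by (simp add: power_mult_distrib mult.assoc)
qed

lemma op_bounded_pow:
  assumes "A \<in> carrier_mat n n" "op_bounded a A"
  shows "op_bounded (a ^ k) (A ^\<^sub>m k)"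
proof (induction k)
  case 0
  show ?case by (simp add: op_bounded_one)
next
  case (Suc k)
  show ?case
    using op_bounded_mult[OF pow_carrier_mat[OF assms(1)] assms(1) Suc assms(2)]
    by (simp add: mult.commute)
qed

text \<open>An entry is a coordinate of a column, and a column is the image of a unit vector, so its
  length is at most \<open>c\<close>.\<close>

lemma entries_bounded_by_op_bounded:
  assumes A: "A \<in> carrier_mat n n" and "op_bounded c A"
  shows "entries_bounded_by A c"
  unfolding entries_bounded_by_def
proof (intro allI impI)
  fix a b assume "a < dim_row A" "b < dim_col A"
  with A have ab: "a < n" "b < n" by auto
  let ?y = "A *\<^sub>v unit_vec n b"
  have y: "?y $ a = A $$ (a, b)" "dim_vec ?y = n"
    using A ab by auto
  have "(A $$ (a, b))\<^sup>2 \<le> (\<Sum>i = 0..<n. ?y $ i * ?y $ i)"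
    using member_le_sum[of a "{0..<n}" "\<lambda>i. ?y $ i * ?y $ i"] ab(1) y
    by (simp add: power2_eq_square)
  also have "\<dots> = ?y \<bullet> ?y" using y by (simp add: scalar_prod_def)
  also have "\<dots> \<le> c\<^sup>2 * (unit_vec n b \<bullet> (unit_vec n b :: real vec))"
    using assms by (auto simp: op_bounded_def)
  also have "\<dots> = c\<^sup>2" using ab by simp
  finally show "\<bar>A $$ (a, b)\<bar> \<le> c"
    using assms(2) by (simp add: op_bounded_def abs_le_square_iff[symmetric])
qed

lemma entries_bounded_by_smult:
  "entries_bounded_by A c \<Longrightarrow> entries_bounded_by (k \<cdot>\<^sub>m A) (\<bar>k\<bar> * c)"
  by (auto simp: entries_bounded_by_def abs_mult mult_left_mono)

section \<open>The resolvent identity\<close>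

text \<open>Multiplying \<open>(A + t \<cdot>\<^sub>m E) * U = 1\<^sub>m n\<close> by
  \<open>W\<close> from the left cancels \<open>A\<close> and leaves
  \<open>W = U + t \<cdot>\<^sub>m ((W * E) * U)\<close>.\<close>

lemma resolvent_identity:
  fixes A E U W :: "real mat"
  assumes [simp]: "A \<in> carrier_mat n n" "E \<in> carrier_mat n n" "W \<in> carrier_mat n n"
      "U \<in> carrier_mat n n"
    and WA: "W * A = 1\<^sub>m n" and VU: "(A + t \<cdot>\<^sub>m E) * U = 1\<^sub>m n"
  shows "U = W + (- t) \<cdot>\<^sub>m ((W * E) * U)"
proof -
  have [simp]: "A * U \<in> carrier_mat n n" "E * U \<in> carrier_mat n n"
    using mult_carrier_mat assms(1,2,4) by blast+
  have "W = W * ((A + t \<cdot>\<^sub>m E) * U)" by (simp add: VU right_mult_one_mat[of W n n])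
  also have "(A + t \<cdot>\<^sub>m E) * U = A * U + t \<cdot>\<^sub>m (E * U)"
    by (simp add: add_mult_distrib_mat[of _ n n _ _ n] mult_smult_assoc_mat[of _ n n _ n])
  also have "W * \<dots> = W * (A * U) + t \<cdot>\<^sub>m (W * (E * U))"
    by (simp add: mult_add_distrib_mat[of _ n n _ n] mult_smult_distrib[of _ n n _ n])
  also have "W * (A * U) = U"
    by (simp add: WA assoc_mult_mat[of W n n A n U n, symmetric] left_mult_one_mat[of U n n])
  also have "W * (E * U) = (W * E) * U"
    by (simp add: assoc_mult_mat[of W n n E n U n])
  finally have W: "W = U + t \<cdot>\<^sub>m ((W * E) * U)" .
  \<comment> \<open>Solving for \<open>U\<close> is done entrywise, where it is subtraction of real
    numbers.\<close>
  have "W $$ (i, j) = U $$ (i, j) + t * ((W * E) * U) $$ (i, j)" if "i < n" "j < n" for i j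
    using arg_cong[OF W, of "\<lambda>X. X $$ (i, j)"] that
      carrier_matD[OF assms(3)] carrier_matD[OF assms(4)]
    by (simp del: index_mult_mat(1))
  then show ?thesis
    using carrier_matD[OF assms(3)] carrier_matD[OF assms(4)]
    by (intro eq_matI) (simp_all del: index_mult_mat(1))
qed

section \<open>Finite sums in the matrix ring and the finite Neumann expansion\<close>

lemma msum_carrier:
  assumes "\<And>l. F l \<in> carrier_mat n n"
  shows "msum n F {0..r} \<in> carrier_mat n n"
proof -
  interpret ring "ring_mat TYPE(real) n ()" by (rule ring_mat)
  show ?thesis using finsum_closed[of F "{0..r}"] assms by (auto simp: ring_mat_simps)
qed

lemma msum_Suc:
  assumes "\<And>l. F l \<in> carrier_mat n n"
  shows "msum n F {0..Suc r} = msum n F {0..r} + F (Suc r)"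
proof -
  interpret ring "ring_mat TYPE(real) n ()" by (rule ring_mat)
  \<comment> \<open>The ring law puts the new term first; commutativity then moves it to the
    end.\<close>
  have "msum n F {..Suc r} = F (Suc r) + msum n F {..r}"
    using finsum_Suc[of F r] assms by (auto simp: ring_mat_simps)
  then show ?thesis
    using comm_add_mat[OF assms[of "Suc r"] msum_carrier[of F n r]] assms by (simp add: atLeast0AtMost)
qed

lemma msum_0:
  assumes "\<And>l. F l \<in> carrier_mat n n"
  shows "msum n F {0..0} = F 0"
proof -
  interpret ring "ring_mat TYPE(real) n ()" by (rule ring_mat)
  show ?thesis
    using finsum_0[of F] assms by (auto simp: ring_mat_simps)
qed

text \<open>Replacing \<open>U\<close> in the remainder by the right-hand side of \<open>eq\<close>
  produces the next term and the next remainder. The identity is exact for every \<open>r\<close>,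
  so no convergence argument enters.\<close>

lemma neumann_expansion:
  fixes T U W :: "real mat"
  assumes T: "T \<in> carrier_mat n n" and W: "W \<in> carrier_mat n n" and U: "U \<in> carrier_mat n n"
    and eq: "U = W + s \<cdot>\<^sub>m (T * U)"
  shows "U = msum n (\<lambda>l. s ^ l \<cdot>\<^sub>m T ^\<^sub>m l) {0..r} * W + s ^ (r + 1) \<cdot>\<^sub>m (T ^\<^sub>m (r + 1) * U)"
proof (induction r)
  case 0
  \<comment> \<open>The term at \<open>l = 0\<close> is the identity with scalar factor
    \<open>s ^ 0 = 1\<close>; this removes that factor.\<close>
  have "1 \<cdot>\<^sub>m W = W" by (rule eq_matI) auto
  then show ?case using eq T W U msum_0[of "\<lambda>l. s ^ l \<cdot>\<^sub>m T ^\<^sub>m l" n]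
    by (simp add: carrier_matD[OF T] mult_smult_assoc_mat[of _ n n _ n])
next
  case (Suc r)
  let ?F = "\<lambda>l. s ^ l \<cdot>\<^sub>m T ^\<^sub>m l"
  let ?P = "T ^\<^sub>m (r + 1)"
  have P: "?P \<in> carrier_mat n n" using T by (rule pow_carrier_mat)
  have F: "?F l \<in> carrier_mat n n" for l using T by simp
  have S: "msum n ?F {0..r} \<in> carrier_mat n n" using F by (rule msum_carrier)
  have TU: "T * U \<in> carrier_mat n n" using T U by simp
  \<comment> \<open>Only the trailing \<open>U\<close> of the old remainder is expanded.\<close>
  have "?P * U = ?P * (W + s \<cdot>\<^sub>m (T * U))" using eq by simp
  also have "\<dots> = ?P * W + s \<cdot>\<^sub>m (?P * T * U)"
    using P W TU T U
    by (simp add: mult_add_distrib_mat[of _ n n _ n] mult_smult_distrib[of _ n n _ n]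
        assoc_mult_mat[of _ n n _ n _ n] del: pow_mat.simps)
  finally have PU: "?P * U = ?P * W + s \<cdot>\<^sub>m (T ^\<^sub>m (r + 2) * U)" by simp
  have C: "?P * W \<in> carrier_mat n n" "T ^\<^sub>m (r + 2) * U \<in> carrier_mat n n"
    using P W T U by (auto simp del: pow_mat.simps)
  have "s ^ (r + 1) \<cdot>\<^sub>m (?P * U) = s ^ (r + 1) \<cdot>\<^sub>m (?P * W) + s ^ (r + 2) \<cdot>\<^sub>m (T ^\<^sub>m (r + 2) * U)"
    unfolding PU using carrier_matD[OF C(1)] carrier_matD[OF C(2)]
    by (intro eq_matI) (simp_all add: algebra_simps del: index_mult_mat(1) pow_mat.simps)
  also have "s ^ (r + 1) \<cdot>\<^sub>m (?P * W) = ?F (r + 1) * W"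
    using P W by (simp add: mult_smult_assoc_mat[of _ n n _ n] del: pow_mat.simps)
  finally have "U = msum n ?F {0..r} * W + (?F (r + 1) * W + s ^ (r + 2) \<cdot>\<^sub>m (T ^\<^sub>m (r + 2) * U))"
    using Suc by simp
  also have "\<dots> = (msum n ?F {0..r} + ?F (r + 1)) * W + s ^ (r + 2) \<cdot>\<^sub>m (T ^\<^sub>m (r + 2) * U)"
    using S F[of "r + 1"] W C(2)
    by (simp add: add_mult_distrib_mat[of _ n n] assoc_add_mat[of _ n n] del: pow_mat.simps)
  finally show ?case by (simp add: msum_Suc[OF F] del: pow_mat.simps)
qed

section \<open>Positive semidefiniteness of \<open>D_mat\<close>\<close>

text \<open>The two main effects and the interaction are factors with levels \<open>i\<close>,
  \<open>j\<close> and \<open>(i, j)\<close>. Nonnegative variances then make \<open>D_mat\<close>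
  positive semidefinite.\<close>

lemma D_mat_eq_level_mats:
  "D_mat va vb vc g h m =
     va \<cdot>\<^sub>m level_mat (n_obs g h m) (\<lambda>a. fst (obs g h m ! a))
     + vb \<cdot>\<^sub>m level_mat (n_obs g h m) (\<lambda>a. fst (snd (obs g h m ! a)))
     + vc \<cdot>\<^sub>m level_mat (n_obs g h m)
         (\<lambda>a. (fst (obs g h m ! a), fst (snd (obs g h m ! a))))"
  by (rule eq_matI) (auto simp: D_mat_def level_mat_def split: prod.splits)

lemma D_mat_carrier [simp]: "D_mat va vb vc g h m \<in> carrier_mat (n_obs g h m) (n_obs g h m)"
  by (simp add: D_mat_def)

lemma coercive_D_mat:
  assumes "0 \<le> va" "0 \<le> vb" "0 \<le> vc"
  shows "coercive 0 (D_mat va vb vc g h m)"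
proof -
  \<comment> \<open>The level type stays arbitrary because the main effects have levels in
    \<open>nat\<close> and the interaction has pairs.\<close>
  have *: "coercive 0 (k \<cdot>\<^sub>m level_mat n f)" if "0 \<le> k"
    for k n and f :: "nat \<Rightarrow> 'b"
    using coercive_smult[OF level_mat_carrier coercive_level_mat that, of n f] by simp
  have add: "coercive 0 (A + B)"
    if "A \<in> carrier_mat n n" "B \<in> carrier_mat n n" "coercive 0 A" "coercive 0 B" for A B n
    using coercive_add[OF that] by simp
  show ?thesis
    unfolding D_mat_eq_level_mats using assms
    by (intro add[of _ "n_obs g h m"]) (auto intro!: * coercive_level_mat)
qed

section \<open>Diagonals that are constant on cells\<close>

definition cell_values :: "(nat \<Rightarrow> nat \<Rightarrow> real) \<Rightarrow> nat \<Rightarrow> nat \<Rightarrow> (nat \<Rightarrow> nat \<Rightarrow> nat) \<Rightarrow> real list" where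
  "cell_values c g h m = concat (map (\<lambda>(i, j). replicate (m i j) (c i j)) (cells g h))"

lemma diag_cells_scalar_blocks:
  "diag_cells g h (\<lambda>i j. c i j \<cdot>\<^sub>m 1\<^sub>m (m i j)) = diag_of_list (cell_values c g h m)"
  using diag_block_mat_scalar_blocks[of "\<lambda>(i, j). c i j" "\<lambda>(i, j). m i j" "cells g h"]
  by (simp add: diag_cells_def cell_values_def case_prod_beta')

text \<open>The length is read off from the known dimension of the block-diagonal matrix, with no
  separate count.\<close>

lemma length_cell_values [simp]: "length (cell_values c g h m) = n_obs g h m"
proof -
  have "diag_of_list (cell_values c g h m) \<in> carrier_mat (n_obs g h m) (n_obs g h m)"
    unfolding diag_cells_scalar_blocks[symmetric] by (rule diag_cells_carrier) simp
  from carrier_matD(1)[OF this] show ?thesis by (simp add: diag_of_list_def)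
qed

lemma set_cell_values: "t \<in> set (cell_values c g h m) \<Longrightarrow> \<exists>i<g. \<exists>j<h. t = c i j"
  by (fastforce simp: cell_values_def cells_def split: if_splits)

lemma map_cell_values: "map f (cell_values c g h m) = cell_values (\<lambda>i j. f (c i j)) g h m"
  by (simp add: cell_values_def map_concat comp_def case_prod_beta')

lemma I_m_M_eq: "I_m_M g h m = diag_of_list (cell_values (\<lambda>i j. real (m i j)) g h m)"
  by (simp add: I_m_M_def diag_cells_scalar_blocks)

lemma I_m_Delta_eq:
  "I_m_Delta g h m =
     diag_of_list (cell_values (\<lambda>i j. 1 - real (m i j) / real (m_U g h m)) g h m)"
  by (simp add: I_m_Delta_def diag_cells_scalar_blocks)

lemma I_m_M_carrier [simp]: "I_m_M g h m \<in> carrier_mat (n_obs g h m) (n_obs g h m)"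
  using diag_of_list_carrier[of "cell_values (\<lambda>i j. real (m i j)) g h m"] by (simp add: I_m_M_eq)

lemma I_m_Delta_carrier [simp]: "I_m_Delta g h m \<in> carrier_mat (n_obs g h m) (n_obs g h m)"
  using diag_of_list_carrier[of "cell_values (\<lambda>i j. 1 - real (m i j) / real (m_U g h m)) g h m"]
  by (simp add: I_m_Delta_eq)

section \<open>Splitting \<open>V_mat\<close> into \<open>V_check\<close> and a diagonal
  perturbation\<close>

lemma V_mat_carrier: "V_mat va vb vc ve g h m \<in> carrier_mat (n_obs g h m) (n_obs g h m)"
  by (simp add: V_mat_def)

lemma V_check_carrier: "V_check va vb vc ve g h m \<in> carrier_mat (n_obs g h m) (n_obs g h m)"
  by (simp add: V_check_def)

text \<open>\<open>D_mat\<close> is common to both sides. On the diagonal, \<open>ve\<close> splits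
  into \<open>ve * m i j / m_U g h m\<close> and
  \<open>ve * (1 - m i j / m_U g h m)\<close>.\<close>

lemma V_mat_eq_V_check_plus:
  "V_mat va vb vc ve g h m = V_check va vb vc ve g h m + ve \<cdot>\<^sub>m I_m_Delta g h m"
proof (rule eq_matI)
  let ?n = "n_obs g h m" and ?U = "real (m_U g h m)"
  let ?M = "cell_values (\<lambda>i j. real (m i j)) g h m"
  fix a b
  assume "a < dim_row (V_check va vb vc ve g h m + ve \<cdot>\<^sub>m I_m_Delta g h m)"
    and "b < dim_col (V_check va vb vc ve g h m + ve \<cdot>\<^sub>m I_m_Delta g h m)"
  then have ab: "a < ?n" "b < ?n"
    by (simp_all add: carrier_matD[OF I_m_Delta_carrier])
  \<comment> \<open>Using \<open>map_cell_values\<close> backwards expresses this diagonal through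
    the list \<open>?M\<close> of cell sizes, so that it can be added to that of
    \<open>I_m_M\<close>.\<close>
  have "I_m_Delta g h m $$ (a, b) = (if a = b then 1 - ?M ! a / ?U else 0)"
    using ab by (simp add: I_m_Delta_eq diag_of_list_def
        map_cell_values[where f = "\<lambda>t. 1 - t / ?U", symmetric])
  moreover have "I_m_M g h m $$ (a, b) = (if a = b then ?M ! a else 0)"
    using ab by (simp add: I_m_M_eq diag_of_list_def)
  ultimately show "V_mat va vb vc ve g h m $$ (a, b)
      = (V_check va vb vc ve g h m + ve \<cdot>\<^sub>m I_m_Delta g h m) $$ (a, b)"
    using ab carrier_matD[OF I_m_Delta_carrier[of g h m]] carrier_matD[OF I_m_M_carrier[of g h m]]
      carrier_matD[OF D_mat_carrier[of va vb vc g h m]]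
    by (simp add: V_mat_def V_check_def algebra_simps)
qed (simp_all add: V_mat_def carrier_matD[OF I_m_Delta_carrier] carrier_matD[OF D_mat_carrier])

section \<open>Bounds in terms of the imbalance\<close>

lemma cell_size_bounds:
  assumes "i < g" "j < h"
  shows "m_L g h m \<le> m i j" "m i j \<le> m_U g h m"
  using assms by (auto simp: m_L_def m_U_def intro!: Min_le Max_ge)

lemma m_U_pos:
  assumes "crossed_design g h m"
  shows "0 < m_U g h m"
proof -
  have "0 < g" "0 < h" "0 < m 0 0" using assms by (auto simp: crossed_design_def Suc_le_eq)
  then show ?thesis using cell_size_bounds(2)[of 0 g 0 h m] by simp
qed

lemma one_minus_imbalance:
  assumes "crossed_design g h m"
  shows "1 - imbalance g h m = real (m_L g h m) / real (m_U g h m)"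
  using m_U_pos[OF assms] by (simp add: imbalance_def field_simps)

lemma coercive_V_mat:
  assumes "0 \<le> va" "0 \<le> vb" "0 \<le> vc" "0 < ve"
  shows "coercive ve (V_mat va vb vc ve g h m)"
proof -
  have "coercive 1 (1\<^sub>m (n_obs g h m))" by (simp add: coercive_def)
  then have "coercive (ve * 1) (ve \<cdot>\<^sub>m 1\<^sub>m (n_obs g h m))"
    using assms by (intro coercive_smult[of _ "n_obs g h m"]) auto
  then show ?thesis
    using coercive_add[OF _ D_mat_carrier _ coercive_D_mat] assms
    by (fastforce simp: V_mat_def)
qed

text \<open>The diagonal part is at least \<open>ve * m_L g h m / m_U g h m\<close>, which equals
  \<open>ve\<close> times one minus the imbalance, and \<open>D_mat\<close> adds a nonnegative
  form.\<close>

lemma coercive_V_check: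
  assumes "crossed_design g h m" "0 \<le> va" "0 \<le> vb" "0 \<le> vc" "0 < ve"
  shows "coercive (ve * (1 - imbalance g h m)) (V_check va vb vc ve g h m)"
proof -
  have "coercive (real (m_L g h m)) (I_m_M g h m)"
    unfolding I_m_M_eq
    by (rule coercive_diag_of_list) (auto dest!: set_cell_values simp: cell_size_bounds)
  then have "coercive (ve / real (m_U g h m) * real (m_L g h m))
      ((ve / real (m_U g h m)) \<cdot>\<^sub>m I_m_M g h m)"
    using assms by (intro coercive_smult[OF I_m_M_carrier]) auto
  then have "coercive (ve / real (m_U g h m) * real (m_L g h m) + 0) (V_check va vb vc ve g h m)"
    unfolding V_check_def using assms
    by (intro coercive_add[of _ "n_obs g h m"] coercive_D_mat) auto
  then show ?thesis
    using one_minus_imbalance[OF assms(1)] by simp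
qed

text \<open>Each diagonal entry lies between 0 and the imbalance, since \<open>m i j\<close> lies
  between \<open>m_L g h m\<close> and \<open>m_U g h m\<close>.\<close>

lemma op_bounded_I_m_Delta:
  assumes "crossed_design g h m" "0 \<le> imbalance g h m"
  shows "op_bounded (imbalance g h m) (I_m_Delta g h m)"
  unfolding I_m_Delta_eq
proof (rule op_bounded_diag_of_list)
  fix t assume "t \<in> set (cell_values (\<lambda>i j. 1 - real (m i j) / real (m_U g h m)) g h m)"
  then obtain i j where "i < g" "j < h" and t: "t = 1 - real (m i j) / real (m_U g h m)"
    by (auto dest!: set_cell_values)
  with cell_size_bounds[of i g j h m] m_U_pos[OF assms(1)]
  have "real (m_L g h m) / real (m_U g h m) \<le> real (m i j) / real (m_U g h m)"
    and "real (m i j) / real (m_U g h m) \<le> 1"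
    by (auto intro: divide_right_mono)
  then show "\<bar>t\<bar> \<le> imbalance g h m"
    using one_minus_imbalance[OF assms(1)] t by linarith
qed fact

theorem theorem4:
  fixes va vb vc ve B :: real and G H M r :: nat
  assumes "0 \<le> va" and "0 \<le> vb" and "0 \<le> vc" and "0 < ve"
    and "va \<le> B" and "vb \<le> B" and "vc \<le> B" and "ve \<le> B"
  shows "\<exists>C::real. \<forall>g h m. crossed_design g h m \<and> g \<le> G \<and> h \<le> H \<and> m_U g h m \<le> M
      \<and> 0 \<le> imbalance g h m \<and> imbalance g h m < 1 / 2 \<longrightarrow>
    (\<exists>R \<in> carrier_mat (n_obs g h m) (n_obs g h m).
       minv (V_mat va vb vc ve g h m) =
         msum (n_obs g h m)
           (\<lambda>l. (- ve) ^ l \<cdot>\<^sub>m (minv (V_check va vb vc ve g h m) * I_m_Delta g h m) ^\<^sub>m l) {0..r}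
           * minv (V_check va vb vc ve g h m) + R
       \<and> entries_bounded_by R
           (C * (imbalance g h m ^ (r + 1) / (1 - imbalance g h m) ^ (r + 1))))"
\<comment> \<open>The constant \<open>1 / ve\<close> is the norm bound for the inverse of
  \<open>V_mat\<close>, the last factor of the remainder.\<close>
proof (intro exI[of _ "1 / ve"] allI impI)
  fix g h m
  assume "crossed_design g h m \<and> g \<le> G \<and> h \<le> H \<and> m_U g h m \<le> M
      \<and> 0 \<le> imbalance g h m \<and> imbalance g h m < 1 / 2"
  then have design: "crossed_design g h m"
    and delta: "0 \<le> imbalance g h m" "imbalance g h m < 1 / 2" by auto
  let ?n = "n_obs g h m" and ?d = "imbalance g h m" and ?E = "I_m_Delta g h m"
  let ?V = "V_mat va vb vc ve g h m" and ?A = "V_check va vb vc ve g h m"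
  define U W T where "U = minv ?V" and "W = minv ?A" and "T = W * ?E"
  note coe_V = coercive_V_mat[OF assms(1-4), of g h m]
  note coe_A = coercive_V_check[OF design assms(1-4)]
  \<comment> \<open>With imbalance below 1/2 the coercivity constant of \<open>V_check\<close> is
    positive, so \<open>V_check\<close> is invertible.\<close>
  have pos: "0 < ve * (1 - ?d)" using assms(4) delta by simp
  note U = coercive_imp_inverse[OF V_mat_carrier coe_V assms(4), folded U_def]
  note W = coercive_imp_inverse[OF V_check_carrier coe_A pos, folded W_def]
  have T: "T \<in> carrier_mat ?n ?n"
    unfolding T_def using W(1) I_m_Delta_carrier by (rule mult_carrier_mat)
  have "U = W + (- ve) \<cdot>\<^sub>m (T * U)"
    unfolding T_def
    using resolvent_identity[OF V_check_carrier I_m_Delta_carrier W(1) U(1) W(3)]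
      U(2)[unfolded V_mat_eq_V_check_plus] by simp
  note expansion = neumann_expansion[OF T W(1) U(1) this, of r]
  let ?R = "(- ve) ^ (r + 1) \<cdot>\<^sub>m (T ^\<^sub>m (r + 1) * U)"
  have P: "T ^\<^sub>m (r + 1) \<in> carrier_mat ?n ?n" using T by (rule pow_carrier_mat)
  have PU: "T ^\<^sub>m (r + 1) * U \<in> carrier_mat ?n ?n" using P U(1) by (rule mult_carrier_mat)
  \<comment> \<open>The inverse of \<open>V_check\<close> contributes
    \<open>1 / (ve * (1 - ?d))\<close> and \<open>I_m_Delta\<close> contributes
    \<open>?d\<close>.\<close>
  have "op_bounded (1 / (ve * (1 - ?d)) * ?d) T"
    unfolding T_def
    by (rule op_bounded_mult[OF W(1) I_m_Delta_carrier
          op_bounded_minv[OF V_check_carrier coe_A pos, folded W_def]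
          op_bounded_I_m_Delta[OF design delta(1)]])
  then have "op_bounded ((1 / (ve * (1 - ?d)) * ?d) ^ (r + 1)) (T ^\<^sub>m (r + 1))"
    by (rule op_bounded_pow[OF T])
  then have "op_bounded ((1 / (ve * (1 - ?d)) * ?d) ^ (r + 1) * (1 / ve)) (T ^\<^sub>m (r + 1) * U)"
    by (rule op_bounded_mult[OF P U(1) _
          op_bounded_minv[OF V_mat_carrier coe_V assms(4), folded U_def]])
  then have "entries_bounded_by (T ^\<^sub>m (r + 1) * U)
      ((1 / (ve * (1 - ?d)) * ?d) ^ (r + 1) * (1 / ve))"
    by (rule entries_bounded_by_op_bounded[OF PU])
  then have "entries_bounded_by ?R
      (\<bar>(- ve) ^ (r + 1)\<bar> * ((1 / (ve * (1 - ?d)) * ?d) ^ (r + 1) * (1 / ve)))"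
    by (rule entries_bounded_by_smult)
  \<comment> \<open>The factor \<open>ve ^ (r + 1)\<close> from the scalar cancels the same power in
    the denominator of the bound for \<open>T ^\<^sub>m (r + 1)\<close>.\<close>
  also have "\<bar>(- ve) ^ (r + 1)\<bar> * ((1 / (ve * (1 - ?d)) * ?d) ^ (r + 1) * (1 / ve))
      = 1 / ve * (?d ^ (r + 1) / (1 - ?d) ^ (r + 1))"
    using assms(4) by (simp add: power_abs power_mult_distrib power_divide del: power_Suc)
  finally have "entries_bounded_by ?R (1 / ve * (?d ^ (r + 1) / (1 - ?d) ^ (r + 1)))" .
  with expansion PU show "\<exists>R \<in> carrier_mat ?n ?n.
       minv ?V = msum ?n (\<lambda>l. (- ve) ^ l \<cdot>\<^sub>m (minv ?A * ?E) ^\<^sub>m l) {0..r} * minv ?A + R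
       \<and> entries_bounded_by R (1 / ve * (?d ^ (r + 1) / (1 - ?d) ^ (r + 1)))"
    unfolding T_def W_def U_def
    by (intro bexI[of _ "(- ve) ^ (r + 1) \<cdot>\<^sub>m ((minv ?A * ?E) ^\<^sub>m (r + 1) * minv ?V)"]) auto
qed

end
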